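(* Let $R$ be a $\ast$-ring that can be embedded (as a unital $\ast$-subring) in a $\ast$-clean von Neumann regular $\ast$-ring having the same projections as $R$. Then: (1) $R$ is almost $\ast$-clean. (2) If $R$ is von Neumann regular, then $R$ is $\ast$-clean. (3) If $R$ is abelian, then $R$ is almost strongly $\ast$-clean.
   Context: All rings are associative and unital. A $\ast$-ring is a ring $R$ with a map $\ast:R\to R$ with $(x+y)^\ast=x^\ast+y^\ast$, $(xy)^\ast=y^\ast x^\ast$, $(x^\ast)^\ast=x$. A projection is an element $p$ with $p^\ast=p=p^2$. "Having the same projections" means every projection of the larger ring lies in (the image of) $R$. A ring is abelian if every idempotent is central. An element of a ring is regular if it is neither a left nor a right zero-divisor. A $\ast$-ring is $\ast$-clean (resp. almost $\ast$-clean) if every element is the sum of a unit (resp. a regular element) and a projection; it is almost strongly $\ast$-clean if every element is the sum of a regular element and a projection that commute with each other. *)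

theory Defs
  imports "HOL-Algebra.Algebra"
begin

locale star_ring = ring R for R (structure) +
  fixes star :: "'a \<Rightarrow> 'a"
  assumes star_closed: "x \<in> carrier R \<Longrightarrow> star x \<in> carrier R"
    and star_add: "\<lbrakk> x \<in> carrier R; y \<in> carrier R \<rbrakk> \<Longrightarrow> star (x \<oplus> y) = star x \<oplus> star y"
    and star_mult: "\<lbrakk> x \<in> carrier R; y \<in> carrier R \<rbrakk> \<Longrightarrow> star (x \<otimes> y) = star y \<otimes> star x"
    and star_star: "x \<in> carrier R \<Longrightarrow> star (star x) = x"

definition projections :: "('a, 'm) ring_scheme \<Rightarrow> ('a \<Rightarrow> 'a) \<Rightarrow> 'a set" where
  "projections R star = {p \<in> carrier R. star p = p \<and> p \<otimes>\<^bsub>R\<^esub> p = p}"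

definition left_zero_divisor :: "('a, 'm) ring_scheme \<Rightarrow> 'a \<Rightarrow> bool" where
  "left_zero_divisor R a \<longleftrightarrow>
    a \<in> carrier R \<and> (\<exists>b\<in>carrier R. b \<noteq> \<zero>\<^bsub>R\<^esub> \<and> a \<otimes>\<^bsub>R\<^esub> b = \<zero>\<^bsub>R\<^esub>)"

definition right_zero_divisor :: "('a, 'm) ring_scheme \<Rightarrow> 'a \<Rightarrow> bool" where
  "right_zero_divisor R a \<longleftrightarrow>
    a \<in> carrier R \<and> (\<exists>b\<in>carrier R. b \<noteq> \<zero>\<^bsub>R\<^esub> \<and> b \<otimes>\<^bsub>R\<^esub> a = \<zero>\<^bsub>R\<^esub>)"

text \<open>Zero counts as a zero divisor exactly when the ring is nontrivial, so a regular element
  is nonzero except in the zero ring, where the only element is regular (and a unit).\<close>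

definition regular_elements :: "('a, 'm) ring_scheme \<Rightarrow> 'a set" where
  "regular_elements R = {a \<in> carrier R. \<not> left_zero_divisor R a \<and> \<not> right_zero_divisor R a}"

definition von_neumann_regular :: "('a, 'm) ring_scheme \<Rightarrow> bool" where
  "von_neumann_regular R \<longleftrightarrow>
    (\<forall>a\<in>carrier R. \<exists>x\<in>carrier R. a \<otimes>\<^bsub>R\<^esub> x \<otimes>\<^bsub>R\<^esub> a = a)"

text \<open>Abelian in the sense of idempotents; multiplication need not be commutative.\<close>

definition abelian_ring :: "('a, 'm) ring_scheme \<Rightarrow> bool" where
  "abelian_ring R \<longleftrightarrow>
    (\<forall>e\<in>carrier R. e \<otimes>\<^bsub>R\<^esub> e = e \<longrightarrow> (\<forall>x\<in>carrier R. e \<otimes>\<^bsub>R\<^esub> x = x \<otimes>\<^bsub>R\<^esub> e))"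

definition star_clean :: "('a, 'm) ring_scheme \<Rightarrow> ('a \<Rightarrow> 'a) \<Rightarrow> bool" where
  "star_clean R star \<longleftrightarrow>
    (\<forall>a\<in>carrier R. \<exists>u\<in>Units R. \<exists>p\<in>projections R star. a = u \<oplus>\<^bsub>R\<^esub> p)"

definition almost_star_clean :: "('a, 'm) ring_scheme \<Rightarrow> ('a \<Rightarrow> 'a) \<Rightarrow> bool" where
  "almost_star_clean R star \<longleftrightarrow>
    (\<forall>a\<in>carrier R. \<exists>r\<in>regular_elements R. \<exists>p\<in>projections R star. a = r \<oplus>\<^bsub>R\<^esub> p)"

definition almost_strongly_star_clean :: "('a, 'm) ring_scheme \<Rightarrow> ('a \<Rightarrow> 'a) \<Rightarrow> bool" where
  "almost_strongly_star_clean R star \<longleftrightarrow>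
    (\<forall>a\<in>carrier R. \<exists>r\<in>regular_elements R. \<exists>p\<in>projections R star.
      a = r \<oplus>\<^bsub>R\<^esub> p \<and> r \<otimes>\<^bsub>R\<^esub> p = p \<otimes>\<^bsub>R\<^esub> r)"

text \<open>Members of \<^const>\<open>ring_hom\<close> preserve the unit, so the image is a unital subring.\<close>

definition star_ring_embedding ::
  "('a, 'm) ring_scheme \<Rightarrow> ('a \<Rightarrow> 'a) \<Rightarrow> ('b, 'n) ring_scheme \<Rightarrow> ('b \<Rightarrow> 'b) \<Rightarrow> ('a \<Rightarrow> 'b) \<Rightarrow> bool"
where
  "star_ring_embedding R star S star' f \<longleftrightarrow>
    f \<in> ring_hom R S \<and> inj_on f (carrier R) \<and> (\<forall>x\<in>carrier R. f (star x) = star' (f x))"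

end

theory Submission
  imports Defs
begin

text \<open>Everything is decided in the larger ring \<open>S\<close> and pulled back along the embedding \<open>f\<close>.
  Write \<open>f a = u \<oplus> q\<close> with \<open>u\<close> a unit and \<open>q\<close> a projection of \<open>S\<close>. Since all projections
  of \<open>S\<close> come from \<open>R\<close>, \<open>q = f p\<close> for a projection \<open>p\<close> of \<open>R\<close>, and \<open>r = a \<ominus> p\<close> lies in \<open>R\<close>
  with \<open>f r = u\<close>. The inverse of \<open>u\<close> may lie outside \<open>R\<close>, so \<open>r\<close> need not be a unit of \<open>R\<close>, but
  cancelling \<open>u\<close> in \<open>S\<close> shows that \<open>r\<close> is not a zero divisor
  (\<open>regular_if_embeds_as_unit\<close>). That proves that \<open>R\<close> is almost \<open>*\<close>-clean. The other two
  claims refine the same decomposition \<open>a = r \<oplus> p\<close>: in a von Neumann regular ring a regular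
  element is already a unit (\<open>regular_element_is_unit\<close>), and in an abelian ring the idempotent
  \<open>p\<close> is central, hence commutes with \<open>r\<close>.\<close>

lemma regular_if_embeds_as_unit:
  assumes "ring R" "ring S" "f \<in> ring_hom R S" "inj_on f (carrier R)"
    and r: "r \<in> carrier R" and unit: "f r \<in> Units S"
  shows "r \<in> regular_elements R"
proof -
  interpret ring_hom_ring R S f
    using assms by (auto intro: ring_hom_ringI2)
  have trivial_if_image_zero: "b = \<zero>\<^bsub>R\<^esub>" if "b \<in> carrier R" "f b = \<zero>\<^bsub>S\<^esub>" for b
    by (rule inj_onD[OF assms(4)]) (use that in simp_all)
  obtain v where v: "v \<in> carrier S" "v \<otimes>\<^bsub>S\<^esub> f r = \<one>\<^bsub>S\<^esub>" "f r \<otimes>\<^bsub>S\<^esub> v = \<one>\<^bsub>S\<^esub>"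
    using unit by (auto simp: Units_def)
  have "b = \<zero>\<^bsub>R\<^esub>" if b: "b \<in> carrier R" and "r \<otimes>\<^bsub>R\<^esub> b = \<zero>\<^bsub>R\<^esub>" for b
  proof -
    have "f r \<otimes>\<^bsub>S\<^esub> f b = \<zero>\<^bsub>S\<^esub>"
      using that r hom_mult[of r b] by simp
    moreover have "v \<otimes>\<^bsub>S\<^esub> (f r \<otimes>\<^bsub>S\<^esub> f b) = f b"
      using v b r by (simp flip: S.m_assoc)
    ultimately show ?thesis
      using v b by (intro trivial_if_image_zero) simp_all
  qed
  moreover have "b = \<zero>\<^bsub>R\<^esub>" if b: "b \<in> carrier R" and "b \<otimes>\<^bsub>R\<^esub> r = \<zero>\<^bsub>R\<^esub>" for b
  proof -
    have "f b \<otimes>\<^bsub>S\<^esub> f r = \<zero>\<^bsub>S\<^esub>"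
      using that r hom_mult[of b r] by simp
    moreover have "(f b \<otimes>\<^bsub>S\<^esub> f r) \<otimes>\<^bsub>S\<^esub> v = f b"
      using v b r by (simp add: S.m_assoc)
    ultimately show ?thesis
      using v b by (intro trivial_if_image_zero) simp_all
  qed
  ultimately show ?thesis
    using r unfolding regular_elements_def left_zero_divisor_def right_zero_divisor_def by blast
qed

text \<open>If \<open>r \<otimes> x \<otimes> r = r\<close>, then \<open>r\<close> annihilates \<open>x \<otimes> r \<ominus> \<one>\<close> from the left and
  \<open>r \<otimes> x \<ominus> \<one>\<close> from the right; regularity makes both vanish, so \<open>x\<close> is a two-sided
  inverse.\<close>

lemma (in ring) regular_element_is_unit:
  assumes "von_neumann_regular R" and reg: "r \<in> regular_elements R"
  shows "r \<in> Units R"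
proof -
  have r: "r \<in> carrier R"
    using reg by (simp add: regular_elements_def)
  obtain x where x: "x \<in> carrier R" "r \<otimes> x \<otimes> r = r"
    using assms(1) r by (auto simp: von_neumann_regular_def)
  have "r \<otimes> (x \<otimes> r \<ominus> \<one>) = \<zero>"
    using r x by (simp add: minus_eq r_distr r_minus r_neg flip: m_assoc)
  hence "x \<otimes> r \<ominus> \<one> = \<zero>"
    using reg r x minus_closed[of "x \<otimes> r" \<one>]
    unfolding regular_elements_def left_zero_divisor_def by blast
  moreover have "(r \<otimes> x \<ominus> \<one>) \<otimes> r = \<zero>"
    using r x by (simp add: minus_eq l_distr l_minus r_neg)
  hence "r \<otimes> x \<ominus> \<one> = \<zero>"
    using reg r x minus_closed[of "r \<otimes> x" \<one>]
    unfolding regular_elements_def right_zero_divisor_def by blast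
  ultimately show ?thesis
    using r x by (auto simp: Units_def)
qed

lemma projection_if_embeds_as_projection:
  assumes "star_ring R star" "star_ring_embedding R star S star' f"
    and "p \<in> carrier R" "f p \<in> projections S star'"
  shows "p \<in> projections R star"
proof -
  interpret star_ring R star by fact
  have "inj_on f (carrier R)" "f (star p) = f p" "f (p \<otimes>\<^bsub>R\<^esub> p) = f p"
    using assms(2-4) by (auto simp: star_ring_embedding_def projections_def ring_hom_mult)
  hence "star p = p" "p \<otimes>\<^bsub>R\<^esub> p = p"
    using assms(3) star_closed[of p] m_closed[of p p] by (simp_all add: inj_on_eq_iff)
  thus ?thesis
    using assms(3) by (simp add: projections_def)
qed

text \<open>The decomposition that serves all three claims.\<close>

lemma regular_plus_projection:
  assumes "star_ring R star" "star_ring S star'" "star_clean S star'"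
    and emb: "star_ring_embedding R star S star' f"
    and same: "projections S star' \<subseteq> f ` carrier R"
    and a: "a \<in> carrier R"
  obtains r p where "r \<in> regular_elements R" "p \<in> projections R star" "a = r \<oplus>\<^bsub>R\<^esub> p"
proof -
  interpret R: star_ring R star by fact
  interpret S: star_ring S star' by fact
  have hom: "f \<in> ring_hom R S" and inj: "inj_on f (carrier R)"
    using emb by (auto simp: star_ring_embedding_def)
  interpret ring_hom_ring R S f
    using hom by unfold_locales
  obtain u q where uq: "u \<in> Units S" "q \<in> projections S star'" "f a = u \<oplus>\<^bsub>S\<^esub> q"
    using assms(3) a hom_closed unfolding star_clean_def by blast
  obtain p where p: "p \<in> carrier R" "q = f p"
    using uq(2) same by auto
  have "f (a \<ominus>\<^bsub>R\<^esub> p) = u"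
    using a p uq S.Units_closed
    by (simp add: R.minus_eq S.a_assoc S.r_neg)
  hence "a \<ominus>\<^bsub>R\<^esub> p \<in> regular_elements R"
    using regular_if_embeds_as_unit[OF R.ring_axioms S.ring_axioms hom inj] a p uq(1) by simp
  moreover have "p \<in> projections R star"
    using projection_if_embeds_as_projection[OF assms(1) emb] p uq(2) by simp
  moreover have "a = (a \<ominus>\<^bsub>R\<^esub> p) \<oplus>\<^bsub>R\<^esub> p"
    using a p by (simp add: R.minus_eq R.a_assoc R.l_neg)
  ultimately show thesis
    using that by blast
qed

theorem proposition8:
  fixes R :: "('a, 'm) ring_scheme" and star :: "'a \<Rightarrow> 'a"
    and S :: "('b, 'n) ring_scheme" and star' :: "'b \<Rightarrow> 'b"
    and f :: "'a \<Rightarrow> 'b"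
  assumes "star_ring R star"
    and "star_ring S star'"
    and "star_clean S star'"
    and "von_neumann_regular S"
    and "star_ring_embedding R star S star' f"
    and "projections S star' \<subseteq> f ` carrier R"
  shows "almost_star_clean R star
    \<and> (von_neumann_regular R \<longrightarrow> star_clean R star)
    \<and> (abelian_ring R \<longrightarrow> almost_strongly_star_clean R star)"
proof (intro conjI impI)
  interpret star_ring R star by fact
  note decomposition = regular_plus_projection[OF assms(1-3,5,6)]
  show "almost_star_clean R star"
    unfolding almost_star_clean_def using decomposition by metis
  show "star_clean R star" if "von_neumann_regular R"
    unfolding star_clean_def using decomposition regular_element_is_unit[OF that] by metis
  show "almost_strongly_star_clean R star" if abelian: "abelian_ring R"
    unfolding almost_strongly_star_clean_def
  proof
    fix a assume "a \<in> carrier R"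
    then obtain r p where rp: "r \<in> regular_elements R" "p \<in> projections R star" "a = r \<oplus>\<^bsub>R\<^esub> p"
      using decomposition by blast
    have "r \<in> carrier R" "p \<in> carrier R" "p \<otimes>\<^bsub>R\<^esub> p = p"
      using rp by (simp_all add: regular_elements_def projections_def)
    hence "r \<otimes>\<^bsub>R\<^esub> p = p \<otimes>\<^bsub>R\<^esub> r"
      using abelian unfolding abelian_ring_def by metis
    thus "\<exists>r\<in>regular_elements R. \<exists>p\<in>projections R star.
        a = r \<oplus>\<^bsub>R\<^esub> p \<and> r \<otimes>\<^bsub>R\<^esub> p = p \<otimes>\<^bsub>R\<^esub> r"
      using rp by blast
  qed
qed

end
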